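(* Let $A$ be a finitely generated domain over a field $\mathbb{K}$ of characteristic zero, let $D\neq 0$ be a locally nilpotent $\mathbb{K}$-derivation of $A$, and let $C=\mathrm{Ker}\,D=\{a\in A: D(a)=0\}$. If $D$ has a slice in $A$ (that is, there exists $s\in A$ with $D(s)=1$), then there is an isomorphism of Lie algebras over $\mathbb{K}$ $$C_{\mathrm{Der}_{\mathbb{K}}A}(D)\simeq C\rtimes \mathrm{Der}_{\mathbb{K}}C,$$ where $C$ is considered as a Lie algebra over $\mathbb{K}$ with zero multiplication (an abelian ideal of the semidirect sum) and $\mathrm{Der}_{\mathbb{K}}C$ acts on $C$ naturally.
   Context: A derivation $D$ is locally nilpotent if for every $a\in A$ there is $k$ with $D^k(a)=0$. $\mathrm{Der}_{\mathbb{K}}B$ is the Lie algebra of $\mathbb{K}$-derivations of a $\mathbb{K}$-algebra $B$. $C_{\mathrm{Der}_{\mathbb{K}}A}(D)=\{T\in\mathrm{Der}_{\mathbb{K}}A : [T,D]=0\}$. The semidirect sum $C\rtimes\mathrm{Der}_{\mathbb{K}}C$ is the vector space $C\oplus\mathrm{Der}_{\mathbb{K}}C$ with bracket $[(c,T),(c',T')]=(T(c')-T'(c),[T,T'])$. *)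

theory Defs
  imports Complex_Main "HOL-Library.Function_Algebras" "HOL-Library.Product_Plus"
begin

locale comm_algebra = vector_space scale
  for scale :: "'k::field \<Rightarrow> 'a::comm_ring_1 \<Rightarrow> 'a" +
  assumes scale_mult_left: "scale c x * y = scale c (x * y)"
begin

definition subalgebra :: "'a set \<Rightarrow> bool" where
  "subalgebra B \<longleftrightarrow> subspace B \<and> 1 \<in> B \<and> (\<forall>x\<in>B. \<forall>y\<in>B. x * y \<in> B)"

definition finitely_generated :: bool where
  "finitely_generated \<longleftrightarrow> (\<exists>S. finite S \<and> subalgebra hull S = UNIV)"

end

text \<open>
  The underlying vector space of a Lie algebra is a linear subspace of a vector space
  carried by a whole type; addition is that of the type. The bracket is only constrained
  on the carrier.
\<close>

record ('k, 'v) lie_alg =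
  lie_carrier :: "'v set"
  lie_scale :: "'k \<Rightarrow> 'v \<Rightarrow> 'v"
  lie_bracket :: "'v \<Rightarrow> 'v \<Rightarrow> 'v"

locale lie_algebra =
  fixes L :: "('k::field, 'v::ab_group_add) lie_alg"
  assumes vector_space: "vector_space (lie_scale L)"
    and subspace: "module.subspace (lie_scale L) (lie_carrier L)"
    and bracket_closed:
      "\<lbrakk>x \<in> lie_carrier L; y \<in> lie_carrier L\<rbrakk> \<Longrightarrow> lie_bracket L x y \<in> lie_carrier L"
    and bracket_add_left:
      "\<lbrakk>x \<in> lie_carrier L; y \<in> lie_carrier L; z \<in> lie_carrier L\<rbrakk> \<Longrightarrow>
        lie_bracket L (x + y) z = lie_bracket L x z + lie_bracket L y z"
    and bracket_add_right:
      "\<lbrakk>x \<in> lie_carrier L; y \<in> lie_carrier L; z \<in> lie_carrier L\<rbrakk> \<Longrightarrow>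
        lie_bracket L x (y + z) = lie_bracket L x y + lie_bracket L x z"
    and bracket_scale_left:
      "\<lbrakk>x \<in> lie_carrier L; y \<in> lie_carrier L\<rbrakk> \<Longrightarrow>
        lie_bracket L (lie_scale L c x) y = lie_scale L c (lie_bracket L x y)"
    and bracket_scale_right:
      "\<lbrakk>x \<in> lie_carrier L; y \<in> lie_carrier L\<rbrakk> \<Longrightarrow>
        lie_bracket L x (lie_scale L c y) = lie_scale L c (lie_bracket L x y)"
    and bracket_self: "x \<in> lie_carrier L \<Longrightarrow> lie_bracket L x x = 0"
    and jacobi:
      "\<lbrakk>x \<in> lie_carrier L; y \<in> lie_carrier L; z \<in> lie_carrier L\<rbrakk> \<Longrightarrow>
        lie_bracket L x (lie_bracket L y z) + lie_bracket L y (lie_bracket L z x) +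
        lie_bracket L z (lie_bracket L x y) = 0"

definition lie_isomorphism ::
    "('k::field, 'v::ab_group_add) lie_alg \<Rightarrow> ('k, 'w::ab_group_add) lie_alg \<Rightarrow>
      ('v \<Rightarrow> 'w) \<Rightarrow> bool" where
  "lie_isomorphism L M \<phi> \<longleftrightarrow>
    bij_betw \<phi> (lie_carrier L) (lie_carrier M) \<and>
    (\<forall>x\<in>lie_carrier L. \<forall>y\<in>lie_carrier L. \<phi> (x + y) = \<phi> x + \<phi> y) \<and>
    (\<forall>c. \<forall>x\<in>lie_carrier L. \<phi> (lie_scale L c x) = lie_scale M c (\<phi> x)) \<and>
    (\<forall>x\<in>lie_carrier L. \<forall>y\<in>lie_carrier L.
      \<phi> (lie_bracket L x y) = lie_bracket M (\<phi> x) (\<phi> y))"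

definition lie_isomorphic ::
    "('k::field, 'v::ab_group_add) lie_alg \<Rightarrow> ('k, 'w::ab_group_add) lie_alg \<Rightarrow> bool" where
  "lie_isomorphic L M \<longleftrightarrow>
    lie_algebra L \<and> lie_algebra M \<and> (\<exists>\<phi>. lie_isomorphism L M \<phi>)"

definition lie_centralizer ::
    "('k, 'v::zero) lie_alg \<Rightarrow> 'v \<Rightarrow> ('k, 'v) lie_alg" where
  "lie_centralizer L d = L\<lparr>lie_carrier := {x \<in> lie_carrier L. lie_bracket L x d = 0}\<rparr>"

text \<open>
  A derivation of a subalgebra \<open>B\<close> is represented by its extension by \<open>0\<close> to the
  ambient type. This makes the representation unique, and pointwise operations and
  the commutator preserve it. For \<open>B = UNIV\<close> the last condition is void.
\<close>

definition derivations :: "('k \<Rightarrow> 'a::comm_ring_1 \<Rightarrow> 'a) \<Rightarrow> 'a set \<Rightarrow> ('a \<Rightarrow> 'a) set" where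
  "derivations scale B = {T.
    (\<forall>x\<in>B. T x \<in> B) \<and>
    (\<forall>x\<in>B. \<forall>y\<in>B. T (x + y) = T x + T y) \<and>
    (\<forall>c. \<forall>x\<in>B. T (scale c x) = scale c (T x)) \<and>
    (\<forall>x\<in>B. \<forall>y\<in>B. T (x * y) = T x * y + x * T y) \<and>
    (\<forall>x. x \<notin> B \<longrightarrow> T x = 0)}"

definition commutator :: "('a::ab_group_add \<Rightarrow> 'a) \<Rightarrow> ('a \<Rightarrow> 'a) \<Rightarrow> 'a \<Rightarrow> 'a" where
  "commutator S T = (\<lambda>x. S (T x) - T (S x))"

definition Der ::
    "('k \<Rightarrow> 'a::comm_ring_1 \<Rightarrow> 'a) \<Rightarrow> 'a set \<Rightarrow> ('k, 'a \<Rightarrow> 'a) lie_alg" where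
  "Der scale B =
    \<lparr>lie_carrier = derivations scale B,
     lie_scale = (\<lambda>c T x. scale c (T x)),
     lie_bracket = commutator\<rparr>"

definition semidirect_Der ::
    "('k \<Rightarrow> 'a::comm_ring_1 \<Rightarrow> 'a) \<Rightarrow> 'a set \<Rightarrow> ('k, 'a \<times> ('a \<Rightarrow> 'a)) lie_alg" where
  "semidirect_Der scale C =
    \<lparr>lie_carrier = C \<times> lie_carrier (Der scale C),
     lie_scale = (\<lambda>k (c, T). (scale k c, lie_scale (Der scale C) k T)),
     lie_bracket = (\<lambda>(c, T) (c', T').
       (T c' - T' c, lie_bracket (Der scale C) T T'))\<rparr>"

definition locally_nilpotent :: "('a::zero \<Rightarrow> 'a) \<Rightarrow> bool" where
  "locally_nilpotent D \<longleftrightarrow> (\<forall>a. \<exists>k. (D ^^ k) a = 0)"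

end

theory Submission
  imports Defs "HOL-Computational_Algebra.Polynomial"
begin

text \<open>
  A slice \<open>s\<close> makes \<open>A\<close> the polynomial ring \<open>C[s]\<close>: uniqueness of the coefficients follows by
  applying \<open>D = d/ds\<close> repeatedly, existence by integrating with respect to \<open>s\<close> along the nilpotency
  order. A derivation \<open>T\<close> commuting with \<open>D\<close> preserves \<open>C\<close> and maps \<open>s\<close> into \<open>C\<close>, because
  \<open>D (T s) = T 1 = 0\<close>; it is determined by \<open>T s\<close> and the restriction of \<open>T\<close> to \<open>C\<close>. Conversely
  \<open>(c, T)\<close> comes from the coefficientwise extension of \<open>T\<close> to \<open>C[s]\<close> plus \<open>c D\<close>.
\<close>

section \<open>Lie algebras of derivations\<close>

lemma derivationsI:
  assumes "\<And>x. x \<in> B \<Longrightarrow> T x \<in> B"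
    and "\<And>x y. x \<in> B \<Longrightarrow> y \<in> B \<Longrightarrow> T (x + y) = T x + T y"
    and "\<And>c x. x \<in> B \<Longrightarrow> T (scale c x) = scale c (T x)"
    and "\<And>x y. x \<in> B \<Longrightarrow> y \<in> B \<Longrightarrow> T (x * y) = T x * y + x * T y"
    and "\<And>x. x \<notin> B \<Longrightarrow> T x = 0"
  shows "T \<in> derivations scale B"
  using assms by (auto simp: derivations_def)

lemma derivationsD:
  assumes "T \<in> derivations scale B"
  shows derivations_closed: "x \<in> B \<Longrightarrow> T x \<in> B"
    and derivations_add: "x \<in> B \<Longrightarrow> y \<in> B \<Longrightarrow> T (x + y) = T x + T y"
    and derivations_scale: "x \<in> B \<Longrightarrow> T (scale c x) = scale c (T x)"
    and derivations_mult: "x \<in> B \<Longrightarrow> y \<in> B \<Longrightarrow> T (x * y) = T x * y + x * T y"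
    and derivations_outside: "x \<notin> B \<Longrightarrow> T x = 0"
  using assms by (auto simp: derivations_def)

lemma Der_simps [simp]:
  "lie_carrier (Der scale B) = derivations scale B"
  "lie_scale (Der scale B) = (\<lambda>c T x. scale c (T x))"
  "lie_bracket (Der scale B) = commutator"
  by (simp_all add: Der_def)

lemma semidirect_Der_simps [simp]:
  "lie_carrier (semidirect_Der scale C) = C \<times> derivations scale C"
  "lie_scale (semidirect_Der scale C) k (c, T) = (scale k c, \<lambda>x. scale k (T x))"
  "lie_bracket (semidirect_Der scale C) (c, T) (c', T') = (T c' - T' c, commutator T T')"
  by (simp_all add: semidirect_Der_def)

lemma lie_centralizer_simps [simp]:
  "lie_carrier (lie_centralizer L d) = {x \<in> lie_carrier L. lie_bracket L x d = 0}"
  "lie_scale (lie_centralizer L d) = lie_scale L"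
  "lie_bracket (lie_centralizer L d) = lie_bracket L"
  by (simp_all add: lie_centralizer_def)

section \<open>Centralizers in a Lie algebra\<close>

context lie_algebra
begin

lemma module_scale: "module (lie_scale L)"
  using vector_space by (simp add: module_iff_vector_space)

lemmas subspace_simps = module.subspace_def[OF module_scale]

lemma zero_closed: "0 \<in> lie_carrier L"
  and add_closed: "x \<in> lie_carrier L \<Longrightarrow> y \<in> lie_carrier L \<Longrightarrow> x + y \<in> lie_carrier L"
  and scale_closed: "x \<in> lie_carrier L \<Longrightarrow> lie_scale L c x \<in> lie_carrier L"
  using subspace by (auto simp: subspace_simps)

lemma bracket_zero_right: "x \<in> lie_carrier L \<Longrightarrow> lie_bracket L x 0 = 0"
  using bracket_add_right[of x 0 0] zero_closed by simp

lemma bracket_zero_left: "x \<in> lie_carrier L \<Longrightarrow> lie_bracket L 0 x = 0"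
  using bracket_add_left[of 0 0 x] zero_closed by simp

lemma bracket_anticomm:
  assumes "x \<in> lie_carrier L" "y \<in> lie_carrier L"
  shows "lie_bracket L x y = - lie_bracket L y x"
proof -
  have "0 = lie_bracket L (x + y) (x + y)"
    using assms by (simp add: bracket_self add_closed)
  also have "\<dots> = lie_bracket L x y + lie_bracket L y x"
    \<comment> \<open>\<open>bracket_self\<close> is kept for a second pass: in the first it could
      collapse the bracket of \<open>x + y\<close> with itself before the expansion.\<close>
    using assms
    by (simp add: bracket_add_left bracket_add_right add_closed) (simp add: bracket_self)
  finally show ?thesis by (simp add: eq_neg_iff_add_eq_0)
qed

text \<open>Closure under the bracket is the Jacobi identity for \<open>x\<close>, \<open>y\<close>,
  \<open>d\<close>: two of its terms vanish, which leaves \<open>[d, [x, y]] = 0\<close>. The other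
  axioms are inherited.\<close>

lemma lie_algebra_centralizer:
  assumes d: "d \<in> lie_carrier L"
  shows "lie_algebra (lie_centralizer L d)"
proof -
  have closed: "lie_bracket L (lie_bracket L x y) d = 0"
    if x: "x \<in> lie_carrier L" "lie_bracket L x d = 0"
      and y: "y \<in> lie_carrier L" "lie_bracket L y d = 0" for x y
  proof -
    have "lie_bracket L d x = 0"
      using bracket_anticomm[OF d x(1)] x(2) by simp
    then have "lie_bracket L d (lie_bracket L x y) = 0"
      using jacobi[OF x(1) y(1) d] x y by (simp add: bracket_zero_right)
    then show ?thesis
      using bracket_anticomm[OF bracket_closed[OF x(1) y(1)] d] by simp
  qed
  have "module.subspace (lie_scale L) {x \<in> lie_carrier L. lie_bracket L x d = 0}"
    using d module.scale_zero_right[OF module_scale]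
    by (auto simp: subspace_simps zero_closed add_closed scale_closed bracket_zero_left
        bracket_add_left bracket_scale_left)
  then show ?thesis
    by (intro lie_algebra.intro)
      (use closed in \<open>auto simp: vector_space bracket_closed bracket_add_left bracket_add_right
          bracket_scale_left bracket_scale_right bracket_self jacobi\<close>)
qed

end

section \<open>Derivations of a subalgebra and the semidirect sum\<close>

context comm_algebra
begin

lemma scale_mult_right: "x * scale c y = scale c (x * y)"
  using scale_mult_left[of c y x] by (simp add: mult.commute)

text \<open>Turns the integer factors produced by \<open>pderiv\<close> into scalars of the field,
  where they can be inverted and pulled through linear maps.\<close>

lemma of_nat_mult_eq_scale: "of_nat n * x = scale (of_nat n) x"
  by (induction n) (simp_all add: algebra_simps scale_left_distrib)

lemma subalgebra_closed:
  assumes "subalgebra B"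
  shows "0 \<in> B" "1 \<in> B" "x \<in> B \<Longrightarrow> y \<in> B \<Longrightarrow> x + y \<in> B" "x \<in> B \<Longrightarrow> y \<in> B \<Longrightarrow> x - y \<in> B"
    "x \<in> B \<Longrightarrow> scale c x \<in> B" "x \<in> B \<Longrightarrow> y \<in> B \<Longrightarrow> x * y \<in> B"
  using assms
  by (auto simp: subalgebra_def subspace_0 subspace_add subspace_diff subspace_scale)

lemma subalgebra_UNIV: "subalgebra UNIV"
  by (simp add: subalgebra_def)

lemma derivations_0:
  assumes "subalgebra B" "T \<in> derivations scale B"
  shows "T 0 = 0"
  using derivations_add[OF assms(2), of 0 0] subalgebra_closed(1)[OF assms(1)] by simp

lemma derivations_1:
  assumes "subalgebra B" "T \<in> derivations scale B"
  shows "T 1 = 0"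
  using derivations_mult[OF assms(2), of 1 1] subalgebra_closed(2)[OF assms(1)] by simp

lemma derivations_diff:
  assumes "subalgebra B" "T \<in> derivations scale B" "x \<in> B" "y \<in> B"
  shows "T (x - y) = T x - T y"
  using derivations_add[OF assms(2), of "x - y" y] subalgebra_closed[OF assms(1)] assms(3,4)
  by (simp add: algebra_simps)

lemma derivations_sum:
  assumes "subalgebra B" "T \<in> derivations scale B" "\<And>i. i \<in> I \<Longrightarrow> f i \<in> B"
  shows "T (\<Sum>i\<in>I. f i) = (\<Sum>i\<in>I. T (f i))"
proof -
  have "sum f I \<in> B \<and> T (sum f I) = (\<Sum>i\<in>I. T (f i))"
    using assms(3)
    by (induction I rule: infinite_finite_induct)
      (auto simp: derivations_0[OF assms(1,2)] subalgebra_closed[OF assms(1)]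
        derivations_add[OF assms(2)])
  then show ?thesis by blast
qed

lemma subalgebra_kernel:
  assumes "D \<in> derivations scale UNIV"
  shows "subalgebra {a. D a = 0}"
  using derivations_0[OF subalgebra_UNIV assms] derivations_1[OF subalgebra_UNIV assms]
  by (auto simp: subalgebra_def subspace_def derivationsD[OF assms])

lemma vector_space_fun: "vector_space (\<lambda>c (T :: 'a \<Rightarrow> 'a) x. scale c (T x))"
  by unfold_locales
    (auto simp: fun_eq_iff scale_right_distrib scale_left_distrib)

lemma module_fun: "module (\<lambda>c (T :: 'a \<Rightarrow> 'a) x. scale c (T x))"
  using vector_space_fun by (simp add: module_iff_vector_space)

lemma derivations_subspace:
  assumes B: "subalgebra B"
  shows "0 \<in> derivations scale B"
    "S \<in> derivations scale B \<Longrightarrow> T \<in> derivations scale B \<Longrightarrow> S + T \<in> derivations scale B"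
    "T \<in> derivations scale B \<Longrightarrow> (\<lambda>x. scale c (T x)) \<in> derivations scale B"
  by (auto simp: derivations_def subalgebra_closed[OF B] algebra_simps scale_right_distrib
      scale_mult_left scale_mult_right)

text \<open>The mixed terms \<open>S x * T y\<close> and \<open>T x * S y\<close> cancel in the
  Leibniz rule. Outside \<open>B\<close> the value is 0 because both maps send 0 to 0.\<close>

lemma commutator_derivations:
  assumes B: "subalgebra B" and S: "S \<in> derivations scale B" and T: "T \<in> derivations scale B"
  shows "commutator S T \<in> derivations scale B"
  by (rule derivationsI)
    (simp_all add: commutator_def subalgebra_closed[OF B] derivationsD[OF S] derivationsD[OF T]
      derivations_0[OF B S] derivations_0[OF B T] scale_right_diff_distrib algebra_simps)

lemma commutator_bilinear:
  assumes B: "subalgebra B"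
    and R: "R \<in> derivations scale B" and S: "S \<in> derivations scale B"
    and T: "T \<in> derivations scale B"
  shows "commutator (R + S) T = commutator R T + commutator S T"
    "commutator R (S + T) = commutator R S + commutator R T"
    "commutator (\<lambda>x. scale c (R x)) S = (\<lambda>x. scale c (commutator R S x))"
    "commutator R (\<lambda>x. scale c (S x)) = (\<lambda>x. scale c (commutator R S x))"
proof -
  \<comment> \<open>Needed at every \<open>x\<close> of the ambient type: on \<open>B\<close> by
    linearity of \<open>U\<close>, elsewhere because \<open>V x\<close> and \<open>W x\<close>
    vanish and \<open>U 0 = 0\<close>.\<close>
  have add: "U (V x + W x) = U (V x) + U (W x)" and sc: "U (scale c (V x)) = scale c (U (V x))"
    if "U \<in> derivations scale B" "V \<in> derivations scale B" "W \<in> derivations scale B" for U V W x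
    using that by (cases "x \<in> B"; simp add: derivationsD derivations_0[OF B])+
  show "commutator (R + S) T = commutator R T + commutator S T"
    "commutator R (S + T) = commutator R S + commutator R T"
    "commutator (\<lambda>x. scale c (R x)) S = (\<lambda>x. scale c (commutator R S x))"
    "commutator R (\<lambda>x. scale c (S x)) = (\<lambda>x. scale c (commutator R S x))"
    using R S T by (simp_all add: commutator_def fun_eq_iff add sc scale_right_diff_distrib)
qed

text \<open>Once additivity has split the inner differences, the triple composites cancel in
  pairs.\<close>

lemma commutator_jacobi:
  assumes B: "subalgebra B"
    and R: "R \<in> derivations scale B" and S: "S \<in> derivations scale B"
    and T: "T \<in> derivations scale B"
  shows "commutator R (commutator S T) + commutator S (commutator T R) +
    commutator T (commutator R S) = 0"
proof -
  have diff: "U (V (W x) - W (V x)) = U (V (W x)) - U (W (V x))"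
    if "U \<in> derivations scale B" "V \<in> derivations scale B" "W \<in> derivations scale B" for U V W x
    using that by (cases "x \<in> B"; simp add: derivationsD derivations_0[OF B] derivations_diff[OF B])
  show ?thesis
    using R S T by (simp add: commutator_def fun_eq_iff diff)
qed

lemma lie_algebra_Der:
  assumes B: "subalgebra B"
  shows "lie_algebra (Der scale B)"
  by (intro lie_algebra.intro)
    (auto simp: vector_space_fun module.subspace_def[OF module_fun] derivations_subspace[OF B]
      commutator_derivations[OF B] commutator_bilinear[OF B] commutator_jacobi[OF B],
      auto simp: commutator_def)

lemma lie_algebra_semidirect_Der:
  assumes B: "subalgebra B"
  shows "lie_algebra (semidirect_Der scale B)"
proof -
  have vs: "vector_space (lie_scale (semidirect_Der scale B))"
    by unfold_locales
      (auto simp: fun_eq_iff scale_right_distrib scale_left_distrib)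
  then have "module (lie_scale (semidirect_Der scale B))"
    by (simp add: module_iff_vector_space)
  note sub = module.subspace_def[OF this]
  \<comment> \<open>Unfolds a commutator only when it is applied to a point. The first component
    then uses that \<open>[S, T]\<close> acts as \<open>S T - T S\<close>, while the second keeps
    its commutators for the lemmas above.\<close>
  have br: "commutator S T x = S (T x) - T (S x)" for S T :: "'a \<Rightarrow> 'a" and x
    by (simp add: commutator_def)
  show ?thesis
    by (intro lie_algebra.intro)
      (auto simp: vs sub zero_prod_def derivations_subspace[OF B] derivationsD
        commutator_derivations[OF B] commutator_bilinear[OF B] subalgebra_closed[OF B]
        derivations_diff[OF B] br scale_right_diff_distrib algebra_simps,
       auto simp: commutator_jacobi[OF B] add.assoc[symmetric], auto simp: commutator_def)
qed

end

section \<open>Derivations with a slice\<close>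

locale slice = comm_algebra scale
  for scale :: "'k::field_char_0 \<Rightarrow> 'a::idom \<Rightarrow> 'a" +
  fixes D :: "'a \<Rightarrow> 'a" and s :: 'a
  assumes derivation: "D \<in> derivations scale UNIV"
    and nilpotent: "locally_nilpotent D"
    and slice: "D s = 1"
begin

abbreviation C :: "'a set" where
  "C \<equiv> {a. D a = 0}"

lemmas C_closed = subalgebra_closed[OF subalgebra_kernel[OF derivation]]

section \<open>Evaluation at the slice, from polynomials over the kernel onto the algebra\<close>

lemma of_nat_mult_inverse: "of_nat (Suc n) * scale (inverse (of_nat (Suc n))) x = x"
  by (simp only: of_nat_mult_eq_scale scale_scale right_inverse of_nat_neq_0 scale_one
      not_False_eq_True)

text \<open>Characteristic zero makes \<open>n + 1\<close> a nonzero scalar; hence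
  \<open>pderiv\<close> kills only constants.\<close>

lemma of_nat_Suc_mult_eq_0: "of_nat (Suc n) * x = 0 \<longleftrightarrow> x = 0" for x :: 'a
  by (simp only: of_nat_mult_eq_scale scale_eq_0_iff of_nat_neq_0 simp_thms)

text \<open>The polynomial ring \<open>C[X]\<close>, cut out of \<open>'a poly\<close> because
  \<open>C\<close> is a set and not a type.\<close>

definition P :: "'a poly set" where
  "P = {p. \<forall>i. coeff p i \<in> C}"

lemma P_memI: "(\<And>i. coeff p i \<in> C) \<Longrightarrow> p \<in> P"
  by (simp add: P_def)

lemma coeff_P: "p \<in> P \<Longrightarrow> coeff p i \<in> C"
  by (simp add: P_def)

lemma C_sum: "(\<And>i. i \<in> I \<Longrightarrow> f i \<in> C) \<Longrightarrow> sum f I \<in> C"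
  by (induction I rule: infinite_finite_induct) (use C_closed(1,3) in auto)

text \<open>\<open>smult (scale c 1)\<close> is the action of the field on polynomials:
  \<open>smult\<close> expects a ring element, and \<open>scale c 1\<close> is the image of
  \<open>c\<close> in the ring.\<close>

lemma P_closed:
  assumes "p \<in> P" "q \<in> P"
  shows "p + q \<in> P" "p - q \<in> P" "p * q \<in> P" "smult (scale c 1) p \<in> P" "pderiv p \<in> P"
proof -
  have C: "coeff p i \<in> C" "coeff q i \<in> C" for i
    using assms by (simp_all add: P_def)
  show "p + q \<in> P" "p - q \<in> P"
    using C_closed(3,4)[OF C] by (simp_all add: P_def)
  show "p * q \<in> P"
    by (rule P_memI, unfold coeff_mult) (intro C_sum C_closed(6) C)
  show "smult (scale c 1) p \<in> P"
    by (rule P_memI, unfold coeff_smult) (intro C_closed C)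
  have "of_nat (Suc i) * coeff p (Suc i) \<in> C" for i
    unfolding of_nat_mult_eq_scale by (rule C_closed(5)[OF C(1)])
  then show "pderiv p \<in> P"
    by (simp add: P_def coeff_pderiv del: of_nat_Suc)
qed

lemma P_pCons: "c \<in> C \<Longrightarrow> p \<in> P \<Longrightarrow> pCons c p \<in> P"
  by (auto simp: P_def coeff_pCons split: nat.splits)

lemma zero_P: "0 \<in> P"
  using C_closed(1) by (simp add: P_def)

text \<open>Chain rule: \<open>T\<close> differentiates the coefficients and the argument. It serves
  both for \<open>D\<close> at the slice and for the injectivity of
  \<open>restriction\<close>.\<close>

lemma derivation_poly:
  assumes T: "T \<in> derivations scale UNIV"
  shows "T (poly p x) = poly (map_poly T p) x + poly (pderiv p) x * T x"
  by (induction p)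
    (simp_all add: derivations_0[OF subalgebra_UNIV T] map_poly_pCons derivationsD[OF T]
      pderiv_pCons algebra_simps)

lemma D_poly:
  assumes "p \<in> P"
  shows "D (poly p s) = poly (pderiv p) s"
proof -
  have "map_poly D p = 0"
    using coeff_P[OF assms]
    by (intro poly_eqI) (simp add: coeff_map_poly derivations_0[OF subalgebra_UNIV derivation])
  then show ?thesis
    by (simp add: derivation_poly[OF derivation] slice)
qed

text \<open>Induction on the degree: applying \<open>D\<close> to the relation gives
  \<open>p'(s) = 0\<close> in smaller degree, so \<open>p' = 0\<close> and \<open>p\<close> is a
  constant, equal to its value at \<open>s\<close>.\<close>

lemma poly_slice_eq_0:
  assumes "p \<in> P" "poly p s = 0"
  shows "p = 0"
  using assms
proof (induction "degree p" arbitrary: p rule: less_induct)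
  case less
  have D0: "poly (pderiv p) s = 0"
    using D_poly[OF less.prems(1)] less.prems(2) derivations_0[OF subalgebra_UNIV derivation]
    by simp
  have "degree p = 0"
  proof (rule ccontr)
    assume deg: "degree p \<noteq> 0"
    have "degree (pderiv p) \<le> degree p - 1"
      by (rule degree_le) (use deg in \<open>auto simp: coeff_pderiv intro!: coeff_eq_0\<close>)
    then have "pderiv p = 0"
      using less.hyps[of "pderiv p"] P_closed(5)[OF less.prems(1,1)] D0 deg by simp
    then have "of_nat (Suc n) * coeff p (Suc n) = 0" for n
      by (metis coeff_pderiv coeff_0)
    then have "coeff p (degree p) = 0"
      using deg by (metis of_nat_Suc_mult_eq_0 not0_implies_Suc)
    then show False using deg by simp
  qed
  then obtain c where "p = [:c:]"
    by (metis degree_eq_zeroE)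
  then show ?case using less.prems(2) by simp
qed

lemma pderiv_surj:
  assumes "q \<in> P"
  obtains r where "r \<in> P" "pderiv r = q"
proof
  \<comment> \<open>Formal integration: \<open>?f i\<close> is the coefficient of
    \<open>X^(i+1)\<close>. The outer \<open>pCons 0\<close> shifts the exponents and sets the
    constant of integration to 0.\<close>
  let ?f = "\<lambda>i. scale (inverse (of_nat (Suc i))) (coeff q i)"
  let ?r = "pCons 0 (\<Sum>i\<le>degree q. monom (?f i) i)"
  \<comment> \<open>Valid for all \<open>n\<close>: beyond the degree of \<open>q\<close> both sides
    are 0.\<close>
  have coeff: "coeff (\<Sum>i\<le>degree q. monom (?f i) i) n = ?f n" for n
    by (auto simp: coeff_sum coeff_eq_0)
  have "(\<Sum>i\<le>degree q. monom (?f i) i) \<in> P"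
    by (rule P_memI, unfold coeff) (intro C_closed(5) coeff_P[OF assms])
  then show "?r \<in> P"
    using P_pCons C_closed(1) by blast
  show "pderiv ?r = q"
    by (rule poly_eqI) (simp only: coeff_pderiv coeff_pCons_Suc coeff of_nat_mult_inverse)
qed

text \<open>Induction on the nilpotency order of \<open>a\<close>: write \<open>D a = q(s)\<close>
  and integrate \<open>q\<close> to \<open>r\<close>. Then \<open>a - r(s)\<close> is killed by
  \<open>D\<close>, so it lies in \<open>C\<close> and can be added to \<open>r\<close> as a
  constant term.\<close>

lemma poly_slice_surj: "\<exists>p\<in>P. poly p s = a"
proof -
  have "\<exists>p\<in>P. poly p s = a" if "(D ^^ k) a = 0" for k
    using that
  proof (induction k arbitrary: a)
    case 0
    then show ?case using zero_P by (auto intro!: bexI[of _ 0])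
  next
    case (Suc k)
    then have "(D ^^ k) (D a) = 0"
      by (simp add: funpow_swap1)
    then obtain q where q: "q \<in> P" "poly q s = D a"
      using Suc.IH by blast
    obtain r where r: "r \<in> P" "pderiv r = q"
      by (rule pderiv_surj[OF q(1)])
    have "D (a - poly r s) = 0"
      using D_poly[OF r(1)] r(2) q(2)
      by (simp add: derivations_diff[OF subalgebra_UNIV derivation])
    then have "r + [:a - poly r s:] \<in> P"
      using r(1) zero_P by (intro P_closed P_pCons) simp_all
    then show ?case
      by (intro bexI[of _ "r + [:a - poly r s:]"]) simp_all
  qed
  then show ?thesis
    using nilpotent unfolding locally_nilpotent_def by blast
qed

text \<open>The inverse of evaluation at \<open>s\<close> on \<open>P\<close>; existence is
  \<open>poly_slice_surj\<close>, uniqueness comes from \<open>poly_slice_eq_0\<close> applied to a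
  difference.\<close>

definition expansion :: "'a \<Rightarrow> 'a poly" where
  "expansion a = (THE p. p \<in> P \<and> poly p s = a)"

lemma expansion_unique: "p \<in> P \<Longrightarrow> poly p s = a \<Longrightarrow> expansion a = p"
  unfolding expansion_def
proof (rule the_equality)
  fix q assume "p \<in> P" "poly p s = a" "q \<in> P \<and> poly q s = a"
  then show "q = p"
    using poly_slice_eq_0[of "q - p"] P_closed(2)[of q p] by simp
qed simp

lemma expansion_P: "expansion a \<in> P"
  and poly_expansion: "poly (expansion a) s = a"
  using poly_slice_surj[of a] expansion_unique by auto

section \<open>Coefficientwise extension of a derivation of the kernel\<close>

definition extension :: "('a \<Rightarrow> 'a) \<Rightarrow> 'a \<Rightarrow> 'a" where
  "extension T a = poly (map_poly T (expansion a)) s"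

lemma extension_poly: "p \<in> P \<Longrightarrow> extension T (poly p s) = poly (map_poly T p) s"
  by (simp add: extension_def expansion_unique)

context
  fixes T
  assumes T: "T \<in> derivations scale C"
begin

lemmas T_derivation =
  derivations_0[OF subalgebra_kernel[OF derivation] T] derivationsD[OF T]

text \<open>This and the next four lemmas show that \<open>map_poly T\<close> is a derivation of
  \<open>P\<close> commuting with \<open>pderiv\<close>. \<open>T\<close> is linear only on
  \<open>C\<close>, hence the membership hypotheses; \<open>T 0 = 0\<close> is the side condition of
  \<open>coeff_map_poly\<close>.\<close>

lemma map_poly_P:
  assumes "p \<in> P"
  shows "map_poly T p \<in> P"
  using T_derivation(2)[OF coeff_P[OF assms]]
  by (simp add: P_def coeff_map_poly T_derivation(1))

lemma map_poly_add:
  assumes "p \<in> P" "q \<in> P"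
  shows "map_poly T (p + q) = map_poly T p + map_poly T q"
  by (rule poly_eqI)
    (simp add: coeff_map_poly T_derivation(1) T_derivation(3)[OF coeff_P coeff_P] assms)

lemma map_poly_scale:
  assumes "p \<in> P"
  shows "map_poly T (smult (scale c 1) p) = smult (scale c 1) (map_poly T p)"
  by (rule poly_eqI)
    (simp add: coeff_map_poly T_derivation(1) T_derivation(4)[OF coeff_P] scale_mult_left assms)

text \<open>The Leibniz rule is applied to each summand of the convolution.\<close>

lemma map_poly_mult:
  assumes p: "p \<in> P" and q: "q \<in> P"
  shows "map_poly T (p * q) = map_poly T p * q + p * map_poly T q"
proof (rule poly_eqI)
  fix n
  have "T (\<Sum>i\<le>n. coeff p i * coeff q (n - i)) = (\<Sum>i\<le>n. T (coeff p i * coeff q (n - i)))"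
    by (rule derivations_sum[OF subalgebra_kernel[OF derivation] T])
      (rule C_closed(6)[OF coeff_P[OF p] coeff_P[OF q]])
  then show "coeff (map_poly T (p * q)) n = coeff (map_poly T p * q + p * map_poly T q) n"
    by (simp add: coeff_map_poly T_derivation(1) coeff_mult sum.distrib
        T_derivation(5)[OF coeff_P[OF p] coeff_P[OF q]])
qed

text \<open>The integer factors of \<open>pderiv\<close> are scalars, so they commute with
  \<open>T\<close> by linearity.\<close>

lemma map_poly_pderiv:
  assumes p: "p \<in> P"
  shows "map_poly T (pderiv p) = pderiv (map_poly T p)"
  by (rule poly_eqI)
    (simp only: coeff_map_poly T_derivation(1) coeff_pderiv of_nat_mult_eq_scale
      T_derivation(4)[OF coeff_P[OF p]])

lemma extension_derivation: "extension T \<in> derivations scale UNIV"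
proof (rule derivationsI)
  fix x y c
  obtain p q where p: "p \<in> P" "x = poly p s" and q: "q \<in> P" "y = poly q s"
    using expansion_P poly_expansion by metis
  show "extension T (x + y) = extension T x + extension T y"
    using extension_poly[OF P_closed(1)[OF p(1) q(1)], of T]
    by (simp add: p q extension_poly map_poly_add)
  show "extension T (x * y) = extension T x * y + x * extension T y"
    using extension_poly[OF P_closed(3)[OF p(1) q(1)], of T]
    by (simp add: p q extension_poly map_poly_mult)
  show "extension T (scale c x) = scale c (extension T x)"
    using extension_poly[OF P_closed(4)[OF p(1) p(1)], of T c]
    by (simp add: p extension_poly map_poly_scale scale_mult_left)
qed simp_all

text \<open>Along evaluation \<open>D\<close> becomes \<open>pderiv\<close>, which commutes with
  \<open>map_poly T\<close>.\<close>

lemma extension_commutes: "D (extension T x) = extension T (D x)"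
proof -
  obtain p where p: "p \<in> P" "x = poly p s"
    using expansion_P poly_expansion by metis
  then show ?thesis
    by (simp add: extension_poly D_poly map_poly_P P_closed(5) map_poly_pderiv)
qed

lemma extension_C: "c \<in> C \<Longrightarrow> extension T c = T c"
  using extension_poly[OF P_pCons[OF _ zero_P], of c T]
  by (simp add: map_poly_pCons T_derivation(1))

text \<open>The expansion of \<open>s\<close> is \<open>[:0, 1:]\<close>, and \<open>T\<close> kills
  both coefficients.\<close>

lemma extension_slice: "extension T s = 0"
proof -
  have "[:0, 1:] \<in> P"
    using C_closed(1,2) zero_P by (intro P_pCons)
  then show ?thesis
    using extension_poly[of "[:0, 1:]" T] derivations_1[OF subalgebra_kernel[OF derivation] T]
    by (simp add: map_poly_pCons T_derivation(1))
qed

end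

section \<open>The isomorphism from the centralizer to the semidirect sum\<close>

definition restriction :: "('a \<Rightarrow> 'a) \<Rightarrow> 'a \<times> ('a \<Rightarrow> 'a)" where
  "restriction T = (T s, \<lambda>x. if x \<in> C then T x else 0)"

lemma centralizer_iff:
  "T \<in> lie_carrier (lie_centralizer (Der scale UNIV) D) \<longleftrightarrow>
    T \<in> derivations scale UNIV \<and> (\<forall>x. D (T x) = T (D x))"
  by (auto simp: commutator_def fun_eq_iff)

lemma centralizer_closed:
  assumes "T \<in> lie_carrier (lie_centralizer (Der scale UNIV) D)"
  shows "x \<in> C \<Longrightarrow> T x \<in> C" "T s \<in> C"
  using assms derivations_0[OF subalgebra_UNIV] derivations_1[OF subalgebra_UNIV]
  unfolding centralizer_iff by (auto simp: slice)

lemma restriction_mem: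
  assumes "T \<in> lie_carrier (lie_centralizer (Der scale UNIV) D)"
  shows "restriction T \<in> lie_carrier (semidirect_Der scale C)"
proof -
  have T: "T \<in> derivations scale UNIV"
    using assms by simp
  have "(\<lambda>x. if x \<in> C then T x else 0) \<in> derivations scale C"
    using centralizer_closed(1)[OF assms] C_closed(3,5,6)
    by (intro derivationsI) (auto simp: derivationsD[OF T])
  then show ?thesis
    using centralizer_closed(2)[OF assms] by (simp add: restriction_def)
qed

text \<open>By the chain rule \<open>derivation_poly\<close>, the value of \<open>T\<close> at
  \<open>p(s)\<close> depends only on \<open>T\<close> on the coefficients, which lie in
  \<open>C\<close>, and on \<open>T s\<close>; every element has the form
  \<open>p(s)\<close>.\<close>

lemma inj_on_restriction: "inj_on restriction (lie_carrier (lie_centralizer (Der scale UNIV) D))"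
proof (rule inj_onI)
  fix S T
  assume "S \<in> lie_carrier (lie_centralizer (Der scale UNIV) D)"
    and "T \<in> lie_carrier (lie_centralizer (Der scale UNIV) D)"
  then have S: "S \<in> derivations scale UNIV" and T: "T \<in> derivations scale UNIV"
    by simp_all
  assume eq: "restriction S = restriction T"
  then have "S x = T x" if "x \<in> C" for x
    using that fun_cong[OF arg_cong[where f = snd, OF eq, unfolded restriction_def snd_conv], of x]
    by simp
  then have "map_poly S p = map_poly T p" if "p \<in> P" for p
    using coeff_P[OF that]
    by (intro poly_eqI) (simp add: coeff_map_poly derivations_0[OF subalgebra_UNIV] S T)
  then have "S (poly p s) = T (poly p s)" if "p \<in> P" for p
    using that eq by (simp add: derivation_poly[OF S] derivation_poly[OF T] restriction_def)
  then show "S = T"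
    using expansion_P poly_expansion by (metis ext)
qed

lemma restriction_surj:
  assumes "y \<in> lie_carrier (semidirect_Der scale C)"
  shows "y \<in> restriction ` lie_carrier (lie_centralizer (Der scale UNIV) D)"
proof -
  obtain c T where y: "y = (c, T)" and c: "c \<in> C" and T: "T \<in> derivations scale C"
    using assms by auto
  \<comment> \<open>The extension has the right values on \<open>C\<close> and vanishes at
    \<open>s\<close>; \<open>c * D\<close> vanishes on \<open>C\<close> and takes the value
    \<open>c\<close> at \<open>s\<close>. It commutes with \<open>D\<close> because
    \<open>D c = 0\<close>.\<close>
  let ?T = "\<lambda>x. extension T x + c * D x"
  note E = extension_derivation[OF T]
  have "?T \<in> derivations scale UNIV"
    by (intro derivationsI)
      (simp_all add: derivationsD[OF E] derivationsD[OF derivation] scale_mult_right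
        scale_right_distrib algebra_simps)
  moreover have "D (?T x) = ?T (D x)" for x
    using c by (simp add: derivationsD[OF derivation] extension_commutes[OF T])
  moreover have "restriction ?T = y"
    using extension_slice[OF T] extension_C[OF T] derivations_outside[OF T]
    by (auto simp: restriction_def y slice fun_eq_iff)
  ultimately show ?thesis
    unfolding centralizer_iff[symmetric] image_iff using centralizer_iff by blast
qed

lemma lie_isomorphism_restriction:
  "lie_isomorphism (lie_centralizer (Der scale UNIV) D) (semidirect_Der scale C) restriction"
  unfolding lie_isomorphism_def
proof (intro conjI ballI allI)
  show "bij_betw restriction (lie_carrier (lie_centralizer (Der scale UNIV) D))
      (lie_carrier (semidirect_Der scale C))"
    unfolding bij_betw_def using inj_on_restriction restriction_mem restriction_surj by blast
next
  fix S T
  assume S: "S \<in> lie_carrier (lie_centralizer (Der scale UNIV) D)"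
    and T: "T \<in> lie_carrier (lie_centralizer (Der scale UNIV) D)"
  show "restriction (S + T) = restriction S + restriction T"
    by (auto simp: restriction_def fun_eq_iff)
  have S0: "S 0 = 0" and T0: "T 0 = 0"
    using S T derivations_0[OF subalgebra_UNIV] by simp_all
  have closed: "D (S x) = 0" "D (T x) = 0" if "D x = 0" for x
    using that centralizer_closed(1)[OF S, of x] centralizer_closed(1)[OF T, of x] by simp_all
  \<comment> \<open>Since \<open>S s\<close> and \<open>T s\<close> lie in \<open>C\<close>, the
    first component \<open>S (T s) - T (S s)\<close> involves only the restricted maps, as the
    semidirect bracket requires.\<close>
  have "D (S s) = 0" "D (T s) = 0"
    using centralizer_closed(2)[OF S] centralizer_closed(2)[OF T] by simp_all
  \<comment> \<open>Cutting off commutes with the commutator: on \<open>C\<close> the inner values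
    stay in \<open>C\<close>; off \<open>C\<close> they are 0, and both maps send 0 to 0.\<close>
  moreover have "(if D x = 0 then commutator S T x else 0) =
      commutator (\<lambda>x. if D x = 0 then S x else 0) (\<lambda>x. if D x = 0 then T x else 0) x" for x
    by (cases "D x = 0") (simp_all add: commutator_def closed S0 T0)
  ultimately show "restriction (lie_bracket (lie_centralizer (Der scale UNIV) D) S T) =
      lie_bracket (semidirect_Der scale C) (restriction S) (restriction T)"
    by (simp add: restriction_def fun_eq_iff) (simp add: commutator_def)
next
  fix c T
  show "restriction (lie_scale (lie_centralizer (Der scale UNIV) D) c T) =
      lie_scale (semidirect_Der scale C) c (restriction T)"
    by (auto simp: restriction_def fun_eq_iff)
qed

end

theorem proposition2:
  fixes scale :: "'k::field_char_0 \<Rightarrow> 'a::idom \<Rightarrow> 'a"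
    and D :: "'a \<Rightarrow> 'a"
  assumes "comm_algebra scale"
    and "comm_algebra.finitely_generated scale"
    and "D \<in> derivations scale UNIV"
    and "D \<noteq> 0"
    and "locally_nilpotent D"
    and "\<exists>s. D s = 1"
  shows "lie_isomorphic
    (lie_centralizer (Der scale UNIV) D)
    (semidirect_Der scale {a. D a = 0})"
proof -
  obtain s where "D s = 1"
    using assms(6) by blast
  then interpret slice scale D s
    using assms by (intro slice.intro slice_axioms.intro)
  show ?thesis
    unfolding lie_isomorphic_def
  proof (intro conjI exI)
    show "lie_algebra (lie_centralizer (Der scale UNIV) D)"
      using lie_algebra.lie_algebra_centralizer[OF lie_algebra_Der[OF subalgebra_UNIV]] derivation
      by simp
    show "lie_algebra (semidirect_Der scale C)"
      by (rule lie_algebra_semidirect_Der[OF subalgebra_kernel[OF derivation]])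
    show "lie_isomorphism (lie_centralizer (Der scale UNIV) D) (semidirect_Der scale C) restriction"
      by (rule lie_isomorphism_restriction)
  qed
qed

end
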